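(* Let $\mathcal X$ be an $M$-poset with the Openness Property (not necessarily geometric), considered with the Up topology, and suppose $\mathcal X$ has discrete type. Then $\mathcal X$ has the homotopy type of a $CW$ complex if and only if each path component of $\mathcal X$ is contractible and the space of path components $\pi_0(\mathcal X)$ is discrete.
   Context: A topological poset is a poset $(\mathcal X,\le)$ with a Hausdorff topology on $\mathcal X$ (the Original topology) such that the order relation $\{(x,y)\mid x\le y\}$ is closed in $\mathcal X\times\mathcal X$. An $M$-poset is a topological poset with a poset map $\mu:\mathcal X\to\mathcal R$ to a finite poset $\mathcal R$ such that $x<y$ implies $\mu(x)<\mu(y)$, and every $X_r=\mu^{-1}(r)$ is a non-empty closed subset of $\mathcal X$. For $A\subseteq\mathcal X$ let $\uparrow A=\{x\in\mathcal X\mid a\le x\text{ for some }a\in A\}$. Openness Property: if $U$ is open in $X_r$ then $\uparrow U$ is open in $\mathcal X$ (Original topology). The Up topology on $\mathcal X$ is the topology with basis $\{\uparrow U\mid U\in\mathcal U_r,\ r\in\mathcal R\}$, where $\mathcal U_r$ is a basis for the topology of $X_r$. Define an equivalence relation on $\mathcal X$ by $p\sim q$ iff there is a finite sequence $x_0=p,x_1,\dots,x_n=q$ in $\mathcal X$ such that for each $i$ either $x_i\le x_{i+1}$ or $x_i\ge x_{i+1}$. Each equivalence class lies in a path component of $\mathcal X$ (Up topology). $\mathcal X$ has discrete type if each equivalence class is an entire path component. The space of path components $\pi_0(Y)$ of a space $Y$ carries the quotient topology from $Y$. *)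

theory Defs
  imports "HOL-Analysis.Analysis"
begin

section \<open>M-posets and the Up topology\<close>

text \<open>The underlying set of a topological poset is \<^term>\<open>topspace X\<close>, where X is the Original
  topology; the order is given by its graph le, so \<^term>\<open>(x, y) \<in> le\<close> means that x is less than or
  equal to y. The predicate \<^const>\<open>partial_order_on\<close> confines le to the underlying set.\<close>

locale topological_poset =
  fixes X :: "'a topology" and le :: "'a rel"
  assumes Hausdorff: "Hausdorff_space X"
    and partial_order: "partial_order_on (topspace X) le"
    and closed_order: "closedin (prod_topology X X) le"

definition stratum :: "'a topology \<Rightarrow> ('a \<Rightarrow> 'r) \<Rightarrow> 'r \<Rightarrow> 'a set" where
  "stratum X \<mu> r = {x \<in> topspace X. \<mu> x = r}"

lemma stratum_subset: "stratum X \<mu> r \<subseteq> topspace X"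
  by (auto simp: stratum_def)

locale M_poset = topological_poset X le
  for X :: "'a topology" and le :: "'a rel" +
  fixes R :: "'r set" and leR :: "'r rel" and \<mu> :: "'a \<Rightarrow> 'r"
  assumes finite_R: "finite R"
    and partial_order_R: "partial_order_on R leR"
    and \<mu>_maps: "\<mu> \<in> topspace X \<rightarrow> R"
    and \<mu>_mono: "(x, y) \<in> le \<Longrightarrow> (\<mu> x, \<mu> y) \<in> leR"
    and \<mu>_strict: "(x, y) \<in> le \<Longrightarrow> x \<noteq> y \<Longrightarrow> (\<mu> x, \<mu> y) \<in> leR \<and> \<mu> x \<noteq> \<mu> y"
    and stratum_nonempty: "r \<in> R \<Longrightarrow> stratum X \<mu> r \<noteq> {}"
    and stratum_closed: "r \<in> R \<Longrightarrow> closedin X (stratum X \<mu> r)"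

definition upset :: "'a rel \<Rightarrow> 'a set \<Rightarrow> 'a set" where
  "upset le A = {x. \<exists>a\<in>A. (a, x) \<in> le}"

definition openness_property :: "'a topology \<Rightarrow> 'a rel \<Rightarrow> 'r set \<Rightarrow> ('a \<Rightarrow> 'r) \<Rightarrow> bool" where
  "openness_property X le R \<mu> \<longleftrightarrow>
     (\<forall>r\<in>R. \<forall>U. openin (subtopology X (stratum X \<mu> r)) U \<longrightarrow> openin X (upset le U))"

definition up_basic :: "'a topology \<Rightarrow> 'a rel \<Rightarrow> 'r set \<Rightarrow> ('a \<Rightarrow> 'r) \<Rightarrow> 'a set \<Rightarrow> bool" where
  "up_basic X le R \<mu> V \<longleftrightarrow>
     (\<exists>r\<in>R. \<exists>U. openin (subtopology X (stratum X \<mu> r)) U \<and> V = upset le U)"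

text \<open>The basis of each stratum is taken to consist of all its open sets; any other choice of bases
  gives the same topology (\<open>up_topology_any_basis\<close>). For an M-poset with the Openness Property the
  sets in question do form a basis of a topology (\<open>openin_up_topology\<close>).\<close>

definition up_topology :: "'a topology \<Rightarrow> 'a rel \<Rightarrow> 'r set \<Rightarrow> ('a \<Rightarrow> 'r) \<Rightarrow> 'a topology" where
  "up_topology X le R \<mu> = topology (arbitrary union_of (up_basic X le R \<mu>))"

lemma upset_Union: "upset le (\<Union>\<U>) = \<Union>(upset le ` \<U>)"
  by (auto simp: upset_def)

lemma up_topology_any_basis:
  fixes X :: "'a topology"
  assumes "\<And>r. r \<in> R \<Longrightarrow> openin (subtopology X (stratum X \<mu> r)) = arbitrary union_of (B r)"
  shows "up_topology X le R \<mu> =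
         topology (arbitrary union_of (\<lambda>V. \<exists>r\<in>R. \<exists>U. B r U \<and> V = upset le U))"
proof -
  let ?Q = "\<lambda>V. \<exists>r\<in>R. \<exists>U. B r U \<and> V = upset le U"
  have 1: "(arbitrary union_of ?Q) V" if b: "up_basic X le R \<mu> V" for V
  proof -
    obtain r U where r: "r \<in> R" and U: "openin (subtopology X (stratum X \<mu> r)) U"
      and V: "V = upset le U"
      using b by (auto simp: up_basic_def)
    from U assms[OF r] obtain \<U> where \<U>: "\<U> \<subseteq> Collect (B r)" "\<Union>\<U> = U"
      by (auto simp: union_of_def)
    have "(arbitrary union_of ?Q) (\<Union>(upset le ` \<U>))"
      using r \<U>(1) by (intro arbitrary_union_of_Union) (auto intro!: arbitrary_union_of_inc)
    then show ?thesis
      by (simp add: V upset_Union flip: \<U>(2))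
  qed
  have 2: "up_basic X le R \<mu> V" if "?Q V" for V
  proof -
    from that obtain r U where r: "r \<in> R" and "B r U" "V = upset le U"
      by blast
    moreover have "openin (subtopology X (stratum X \<mu> r)) U"
      using assms[OF r] \<open>B r U\<close> by (simp add: arbitrary_union_of_inc)
    ultimately show ?thesis
      by (auto simp: up_basic_def)
  qed
  have mono: "(arbitrary union_of Q) S"
    if "(arbitrary union_of P) S" and PQ: "\<And>V. P V \<Longrightarrow> (arbitrary union_of Q) V" for P Q and S :: "'a set"
  proof -
    obtain \<U> where \<U>: "\<U> \<subseteq> Collect P" "\<Union>\<U> = S"
      using \<open>(arbitrary union_of P) S\<close> by (auto simp: union_of_def)
    have "(arbitrary union_of Q) (\<Union>\<U>)"
      using \<U>(1) PQ by (intro arbitrary_union_of_Union) auto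
    then show ?thesis
      by (simp add: \<U>(2))
  qed
  have "(arbitrary union_of (up_basic X le R \<mu>)) S \<longleftrightarrow> (arbitrary union_of ?Q) S" for S
  proof
    show "(arbitrary union_of ?Q) S" if "(arbitrary union_of (up_basic X le R \<mu>)) S"
      using that by (rule mono) (rule 1)
    show "(arbitrary union_of (up_basic X le R \<mu>)) S" if "(arbitrary union_of ?Q) S"
      using that by (rule mono) (rule arbitrary_union_of_inc, rule 2)
  qed
  then have "arbitrary union_of (up_basic X le R \<mu>) = arbitrary union_of ?Q"
    by blast
  then show ?thesis
    by (simp add: up_topology_def)
qed

context M_poset
begin

lemma openin_up_topology:
  assumes "openness_property X le R \<mu>"
  shows "openin (up_topology X le R \<mu>) = arbitrary union_of (up_basic X le R \<mu>)"
proof -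
  have po: "refl_on (topspace X) le" "trans le" "le \<subseteq> topspace X \<times> topspace X"
    using partial_order by (auto dest: partial_order_onD)
  have "(arbitrary union_of (up_basic X le R \<mu>)) (S \<inter> T)"
    if S: "up_basic X le R \<mu> S" and T: "up_basic X le R \<mu> T" for S T
  proof -
    have *: "openin X W \<and> (\<forall>x y. x \<in> W \<longrightarrow> (x, y) \<in> le \<longrightarrow> y \<in> W)"
      if "up_basic X le R \<mu> W" for W
    proof -
      from that obtain r U where "r \<in> R" "openin (subtopology X (stratum X \<mu> r)) U" "W = upset le U"
        by (auto simp: up_basic_def)
      then show ?thesis
        using assms transD[OF po(2)] unfolding openness_property_def upset_def by blast
    qed
    define W where "W = (\<lambda>r. stratum X \<mu> r \<inter> (S \<inter> T))"
    have op: "openin X (S \<inter> T)"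
      using * S T by blast
    have W: "up_basic X le R \<mu> (upset le (W r))" if "r \<in> R" for r
      using that op unfolding up_basic_def W_def by (blast intro: openin_subtopology_Int2)
    have "S \<inter> T = \<Union>((\<lambda>r. upset le (W r)) ` R)"
    proof
      show "S \<inter> T \<subseteq> \<Union>((\<lambda>r. upset le (W r)) ` R)"
      proof
        fix x assume x: "x \<in> S \<inter> T"
        then have xX: "x \<in> topspace X"
          using op openin_subset by blast
        then have "x \<in> upset le (W (\<mu> x))"
          using x po(1) by (auto simp: upset_def W_def stratum_def refl_on_def)
        then show "x \<in> \<Union>((\<lambda>r. upset le (W r)) ` R)"
          using xX \<mu>_maps by blast
      qed
      show "\<Union>((\<lambda>r. upset le (W r)) ` R) \<subseteq> S \<inter> T"
        using *[OF S] *[OF T] by (auto simp: upset_def W_def)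
    qed
    moreover have "(arbitrary union_of (up_basic X le R \<mu>)) (\<Union>((\<lambda>r. upset le (W r)) ` R))"
      using W by (intro arbitrary_union_of_Union) (auto intro: arbitrary_union_of_inc)
    ultimately show ?thesis
      by simp
  qed
  then have "istopology (arbitrary union_of (up_basic X le R \<mu>))"
    by (simp add: istopology_base_eq)
  then show ?thesis
    by (simp add: up_topology_def topology_inverse')
qed

lemma topspace_up_topology:
  assumes "openness_property X le R \<mu>"
  shows "topspace (up_topology X le R \<mu>) = topspace X"
proof -
  have po: "refl_on (topspace X) le" "le \<subseteq> topspace X \<times> topspace X"
    using partial_order by (auto dest: partial_order_onD)
  have "S \<subseteq> topspace X" if "(arbitrary union_of (up_basic X le R \<mu>)) S" for S
  proof -
    have "V \<subseteq> topspace X" if "up_basic X le R \<mu> V" for V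
      using that po(2) by (auto simp: up_basic_def upset_def)
    with that show ?thesis
      unfolding union_of_def by blast
  qed
  moreover have "(arbitrary union_of (up_basic X le R \<mu>)) (\<Union>((\<lambda>r. upset le (stratum X \<mu> r)) ` R))"
  proof -
    have "up_basic X le R \<mu> (upset le (stratum X \<mu> r))" if "r \<in> R" for r
    proof -
      have "openin (subtopology X (stratum X \<mu> r)) (stratum X \<mu> r)"
        by (metis openin_topspace stratum_subset topspace_subtopology_subset)
      with that show ?thesis
        by (auto simp: up_basic_def)
    qed
    then show ?thesis
      by (intro arbitrary_union_of_Union) (auto intro: arbitrary_union_of_inc)
  qed
  moreover have "topspace X \<subseteq> \<Union>((\<lambda>r. upset le (stratum X \<mu> r)) ` R)"
  proof
    fix x assume x: "x \<in> topspace X"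
    then have "x \<in> upset le (stratum X \<mu> (\<mu> x))"
      using po(1) by (auto simp: upset_def stratum_def refl_on_def)
    then show "x \<in> \<Union>((\<lambda>r. upset le (stratum X \<mu> r)) ` R)"
      using x \<mu>_maps by blast
  qed
  ultimately show ?thesis
    by (metis openin_up_topology[OF assms] openin_subset openin_topspace subset_antisym subset_trans)
qed

end


section \<open>Discrete type\<close>

definition zigzag :: "'a topology \<Rightarrow> 'a rel \<Rightarrow> 'a rel" where
  "zigzag X le = {(p, q). p \<in> topspace X \<and> q \<in> topspace X \<and> (p, q) \<in> (le \<union> le\<inverse>)\<^sup>*}"

definition discrete_type :: "'a topology \<Rightarrow> 'a rel \<Rightarrow> 'r set \<Rightarrow> ('a \<Rightarrow> 'r) \<Rightarrow> bool" where
  "discrete_type X le R \<mu> \<longleftrightarrow>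
     (\<forall>E \<in> topspace X // zigzag X le. E \<in> path_components_of (up_topology X le R \<mu>))"


section \<open>The space of path components\<close>

definition pi0 :: "'a topology \<Rightarrow> 'a set topology" where
  "pi0 Y = topology (\<lambda>\<C>. \<C> \<subseteq> path_components_of Y \<and>
                         openin Y {y \<in> topspace Y. path_component_of_set Y y \<in> \<C>})"

lemma openin_pi0:
  "openin (pi0 Y) \<C> \<longleftrightarrow>
     \<C> \<subseteq> path_components_of Y \<and> openin Y {y \<in> topspace Y. path_component_of_set Y y \<in> \<C>}"
proof -
  let ?P = "\<lambda>\<C>. \<C> \<subseteq> path_components_of Y \<and>
                 openin Y {y \<in> topspace Y. path_component_of_set Y y \<in> \<C>}"
  have "?P (S \<inter> T)" if "?P S" "?P T" for S T
  proof -
    have "{y \<in> topspace Y. path_component_of_set Y y \<in> S \<inter> T} =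
          {y \<in> topspace Y. path_component_of_set Y y \<in> S} \<inter>
          {y \<in> topspace Y. path_component_of_set Y y \<in> T}"
      by blast
    then show ?thesis
      using that by (simp add: openin_Int le_infI1)
  qed
  moreover have "?P (\<Union>\<K>)" if "\<forall>K\<in>\<K>. ?P K" for \<K>
  proof -
    have "{y \<in> topspace Y. path_component_of_set Y y \<in> \<Union>\<K>} =
          \<Union>((\<lambda>K. {y \<in> topspace Y. path_component_of_set Y y \<in> K}) ` \<K>)"
      by blast
    moreover have "openin Y (\<Union>((\<lambda>K. {y \<in> topspace Y. path_component_of_set Y y \<in> K}) ` \<K>))"
      using that by (intro openin_Union) auto
    ultimately show ?thesis
      using that by (simp add: Sup_le_iff)
  qed
  ultimately have "istopology ?P"
    by (auto simp only: istopology_def)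
  then show ?thesis
    by (simp add: pi0_def topology_inverse')
qed

lemma topspace_pi0: "topspace (pi0 Y) = path_components_of Y"
proof -
  have "{y \<in> topspace Y. path_component_of_set Y y \<in> path_components_of Y} = topspace Y"
    by (auto simp: path_components_of_def)
  then have "openin (pi0 Y) (path_components_of Y)"
    by (simp add: openin_pi0)
  moreover have "topspace (pi0 Y) \<subseteq> path_components_of Y"
    using openin_topspace[of "pi0 Y"] unfolding openin_pi0 by (rule conjunct1)
  ultimately show ?thesis
    by (simp add: openin_subset subset_antisym)
qed

lemma quotient_map_pi0: "quotient_map Y (pi0 Y) (path_component_of_set Y)"
  by (auto simp: quotient_map_def topspace_pi0 path_components_of_def openin_pi0)


section \<open>CW complexes\<close>

definition cw_disc :: "nat \<Rightarrow> (nat \<Rightarrow> real) topology" where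
  "cw_disc n = subtopology (Euclidean_space n) {x. (\<Sum>i<n. (x i)\<^sup>2) \<le> 1}"

definition cw_open_disc :: "nat \<Rightarrow> (nat \<Rightarrow> real) set" where
  "cw_open_disc n = {x \<in> topspace (Euclidean_space n). (\<Sum>i<n. (x i)\<^sup>2) < 1}"

text \<open>The index is that of the disc, so this is the (n-1)-sphere, and it is empty for n = 0.\<close>

definition cw_disc_boundary :: "nat \<Rightarrow> (nat \<Rightarrow> real) set" where
  "cw_disc_boundary n = {x \<in> topspace (Euclidean_space n). (\<Sum>i<n. (x i)\<^sup>2) = 1}"

text \<open>Whitehead's definition: a Hausdorff space partitioned into open cells, each with a
  characteristic map from a disc, subject to closure finiteness and to the weak topology. The open
  cells are non-empty and pairwise disjoint, so they can serve as their own indices: the set \<E>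
  consists of the open cells, and d and \<Phi> give the dimension and the characteristic map of each.\<close>

definition CW_structure ::
  "'b topology \<Rightarrow> 'b set set \<Rightarrow> ('b set \<Rightarrow> nat) \<Rightarrow> ('b set \<Rightarrow> (nat \<Rightarrow> real) \<Rightarrow> 'b) \<Rightarrow> bool" where
  "CW_structure Y \<E> d \<Phi> \<longleftrightarrow>
     Hausdorff_space Y \<and>
     disjoint \<E> \<and> \<Union>\<E> = topspace Y \<and>
     (\<forall>e\<in>\<E>.
        continuous_map (cw_disc (d e)) Y (\<Phi> e) \<and>
        homeomorphic_map (subtopology (cw_disc (d e)) (cw_open_disc (d e))) (subtopology Y e) (\<Phi> e) \<and>
        (\<exists>\<F>. finite \<F> \<and> \<F> \<subseteq> {e' \<in> \<E>. d e' < d e} \<and> \<Phi> e ` cw_disc_boundary (d e) \<subseteq> \<Union>\<F>)) \<and>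
     (\<forall>A. A \<subseteq> topspace Y \<longrightarrow> (\<forall>e\<in>\<E>. closedin Y (A \<inter> Y closure_of e)) \<longrightarrow> closedin Y A)"

definition CW_complex :: "'b topology \<Rightarrow> bool" where
  "CW_complex Y \<longleftrightarrow> (\<exists>\<E> d \<Phi>. CW_structure Y \<E> d \<Phi>)"

text \<open>HOL cannot quantify over types inside a formula, so the carrier type of the CW complex has to be
  named. A complex carried by any type \<open>'c\<close> has a homeomorphic copy in the type used here, so
  leaving \<open>'c\<close> arbitrary covers all CW complexes. The summand \<open>'a \<times> real\<close> makes the notion
  independent of \<open>'c\<close>: a space on \<open>'a\<close> that has the homotopy type of some CW complex also has that
  of one of cardinality at most that of \<open>'a \<times> real\<close>, because it is dominated by a subcomplex with
  at most max(|\<open>'a\<close>|, aleph-0) cells (each point of the image lies in a finite subcomplex), and one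
  can pass to the mapping telescope of the resulting homotopy idempotent.\<close>

definition has_CW_homotopy_type :: "'c itself \<Rightarrow> 'a topology \<Rightarrow> bool" where
  "has_CW_homotopy_type _ X \<longleftrightarrow>
     (\<exists>Y :: ('a \<times> real + 'c) topology. CW_complex Y \<and> X homotopy_equivalent_space Y)"

end

theory Submission
  imports Defs
begin

text \<open>Open sets of the Up topology are up-closed, so a continuous map f to a Hausdorff space identifies
  comparable points; under discrete type it is therefore constant on path components. If f is a
  homotopy equivalence to a CW complex with inverse g, then a homotopy from \<open>g \<circ> f\<close> to the identity
  preserves path components and thus contracts each of them, and each of them is the preimage of a
  path component of the complex, which is open by the weak topology. Conversely, contractions of open
  path components glue to a homotopy equivalence with a discrete space.\<close>

section \<open>Path components of CW complexes\<close>

lemma topspace_cw_disc: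
  "topspace (cw_disc n) = {x. (\<forall>i\<ge>n. x i = 0) \<and> (\<Sum>i<n. (x i)\<^sup>2) \<le> 1}"
  by (auto simp: cw_disc_def topspace_Euclidean_space)

text \<open>\<open>Euclidean_space n\<close> is itself a subspace of the countable power of the
  reals. Compactness of the disc and continuity of maps into it can therefore be checked in that
  product.\<close>

lemma cw_disc_eq_subtopology:
  "cw_disc n = subtopology (powertop_real UNIV) (topspace (cw_disc n))"
  unfolding topspace_cw_disc
  by (simp add: cw_disc_def Euclidean_space_def subtopology_subtopology Collect_conj_eq)

text \<open>The conditions \<open>x i = 0\<close> for \<open>i \<ge> n\<close> and
  \<open>(\<Sum>i<n. (x i)\<^sup>2) \<le> 1\<close> are closed in the countable power of the reals,
  and they force every coordinate into \<open>{-1..1}\<close>. The disc is thus a closed subset of a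
  cube that is compact by Tychonoff's theorem.\<close>

lemma compact_space_cw_disc: "compact_space (cw_disc n)"
proof -
  let ?P = "powertop_real (UNIV :: nat set)"
  have coord: "continuous_map ?P euclideanreal (\<lambda>x. x i)" for i
    by (rule continuous_map_product_projection) simp
  have "topspace (cw_disc n) = (\<Inter>i\<in>{n..}. {x \<in> topspace ?P. x i \<in> {0}}) \<inter>
      {x \<in> topspace ?P. (\<Sum>i<n. (x i)\<^sup>2) \<in> {..1}}"
    by (auto simp: topspace_cw_disc)
  moreover have "closedin ?P {x \<in> topspace ?P. (\<Sum>i<n. (x i)\<^sup>2) \<in> {..1}}"
  proof (rule closedin_continuous_map_preimage)
    show "continuous_map ?P euclideanreal (\<lambda>x. \<Sum>i<n. (x i)\<^sup>2)"
      by (intro continuous_map_sum continuous_map_real_pow coord) auto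
  qed simp
  moreover have "closedin ?P {x \<in> topspace ?P. x i \<in> {0}}" for i
    by (rule closedin_continuous_map_preimage[OF coord]) simp
  ultimately have closed: "closedin ?P (topspace (cw_disc n))"
    by (auto intro!: closedin_Int closedin_INT)
  have "x i \<in> {-1..1}" if x: "x \<in> topspace (cw_disc n)" for x i
  proof (cases "i < n")
    case True
    have "(x i)\<^sup>2 \<le> (\<Sum>i<n. (x i)\<^sup>2)"
      using True by (intro member_le_sum) auto
    then have "(x i)\<^sup>2 \<le> 1"
      using x by (simp add: topspace_cw_disc)
    then show ?thesis
      by (simp add: abs_square_le_1 abs_le_iff)
  next
    case False
    then show ?thesis
      using x by (simp add: topspace_cw_disc)
  qed
  then have "topspace (cw_disc n) \<subseteq> PiE UNIV (\<lambda>i. {-1..1})"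
    by (auto simp: PiE_UNIV_domain)
  moreover have "compactin ?P (PiE UNIV (\<lambda>i. {-1..1}))"
    by (simp add: compactin_PiE)
  ultimately have "compactin ?P (topspace (cw_disc n))"
    using closed by (metis closed_compactin)
  then show ?thesis
    using cw_disc_eq_subtopology[of n] by (metis compact_space_subtopology)
qed

text \<open>The disc is star-shaped about the origin: scaling a point by \<open>t\<close> gives a
  path inside the disc.\<close>

lemma path_connected_space_cw_disc: "path_connected_space (cw_disc n)"
proof -
  let ?I = "top_of_set {0..1::real}"
  have "path_component_of (cw_disc n) (\<lambda>_. 0) x" if x: "x \<in> topspace (cw_disc n)" for x
  proof -
    have "pathin (cw_disc n) (\<lambda>t i. t * x i)"
      unfolding pathin_def
    proof (subst cw_disc_eq_subtopology, intro continuous_map_into_subtopology)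
      show "continuous_map ?I (powertop_real UNIV) (\<lambda>t i. t * x i)"
        by (auto simp: continuous_map_componentwise_UNIV intro!: continuous_intros)
      show "(\<lambda>t i. t * x i) \<in> topspace ?I \<rightarrow> topspace (cw_disc n)"
      proof
        fix t assume t: "t \<in> topspace ?I"
        have "(\<Sum>i<n. (t * x i)\<^sup>2) = t\<^sup>2 * (\<Sum>i<n. (x i)\<^sup>2)"
          by (simp add: power_mult_distrib sum_distrib_left)
        also have "\<dots> \<le> 1"
          using t x by (intro mult_le_one sum_nonneg) (auto simp: topspace_cw_disc power_le_one)
        finally show "(\<lambda>i. t * x i) \<in> topspace (cw_disc n)"
          using x by (simp add: topspace_cw_disc)
      qed
    qed
    then show ?thesis
      unfolding path_component_of_def by (intro exI[of _ "\<lambda>t i. t * x i"]) auto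
  qed
  then show ?thesis
    unfolding path_connected_space_iff_path_component
    by (meson path_component_of_sym path_component_of_trans)
qed

text \<open>A closed cell lies in the image of a path-connected disc, hence entirely inside
  \<open>C\<close> or entirely outside. So the complement of \<open>C\<close> meets each closed cell
  in a closed set, and the weak topology makes it closed.\<close>

lemma openin_path_components_CW:
  assumes "CW_complex K" and C: "C \<in> path_components_of K"
  shows "openin K C"
proof -
  obtain \<E> d \<Phi> where cw: "CW_structure K \<E> d \<Phi>"
    using assms(1) by (auto simp: CW_complex_def)
  have "closedin K ((topspace K - C) \<inter> K closure_of e)" if e: "e \<in> \<E>" for e
  proof -
    let ?D = "\<Phi> e ` topspace (cw_disc (d e))"
    have K: "Hausdorff_space K" and eK: "e \<subseteq> topspace K"
      and cont: "continuous_map (cw_disc (d e)) K (\<Phi> e)"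
      and hom: "homeomorphic_map (subtopology (cw_disc (d e)) (cw_open_disc (d e)))
        (subtopology K e) (\<Phi> e)"
      using cw e by (auto simp: CW_structure_def)
    \<comment> \<open>The image of the disc is compact, hence closed in the Hausdorff space
      \<open>K\<close>; as it contains the open cell, it contains the closure.\<close>
    have "e \<subseteq> ?D"
      using homeomorphic_imp_surjective_map[OF hom] eK by auto
    moreover have "closedin K ?D"
      using K cont compact_space_cw_disc[of "d e"]
      by (auto intro!: compactin_imp_closedin image_compactin simp: compact_space_def)
    ultimately have cl: "K closure_of e \<subseteq> ?D"
      by (rule closure_of_minimal)
    have "path_connectedin K ?D"
      using path_connected_space_cw_disc[of "d e"] cont
      by (auto intro!: path_connectedin_continuous_map_image simp: path_connectedin_topspace)
    then have "?D \<subseteq> C \<or> disjnt C ?D"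
      by (meson C path_components_of_maximal disjnt_sym)
    then have "(topspace K - C) \<inter> K closure_of e = {} \<or>
        (topspace K - C) \<inter> K closure_of e = K closure_of e"
      using cl closure_of_subset_topspace[of K e] by (auto simp: disjnt_iff)
    then show ?thesis
      by auto
  qed
  then have "closedin K (topspace K - C)"
    using cw unfolding CW_structure_def by blast
  then show ?thesis
    using C path_components_of_subset by (metis openin_closedin_eq)
qed

section \<open>Homotopies and path components\<close>

lemma path_component_of_set_eq_component:
  assumes "C \<in> path_components_of Y" "y \<in> C"
  shows "path_component_of_set Y y = C"
proof -
  obtain x where "C = path_component_of_set Y x"
    using assms(1) by (auto simp: path_components_of_def)
  then have "path_component_of Y y = path_component_of Y x"
    using assms(2) by (metis mem_Collect_eq path_component_of_equiv)
  then show ?thesis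
    using \<open>C = path_component_of_set Y x\<close> by simp
qed

text \<open>The track of \<open>x\<close> under the homotopy is the required path.\<close>

lemma homotopic_imp_path_component_of:
  assumes "homotopic_with (\<lambda>_. True) X Y f g" and x: "x \<in> topspace X"
  shows "path_component_of Y (f x) (g x)"
proof -
  obtain h where h: "continuous_map (prod_topology (top_of_set {0..1::real}) X) Y h"
    and h0: "\<And>x. h (0, x) = f x" and h1: "\<And>x. h (1, x) = g x"
    using assms(1) by (auto simp: homotopic_with_def)
  have "continuous_map (top_of_set {0..1}) (prod_topology (top_of_set {0..1::real}) X) (\<lambda>t. (t, x))"
    using x by (auto intro!: continuous_map_pairedI)
  then have "pathin Y (h \<circ> (\<lambda>t. (t, x)))"
    unfolding pathin_def using h by (rule continuous_map_compose)
  then show ?thesis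
    unfolding path_component_of_def using h0 h1 by (intro exI[of _ "h \<circ> (\<lambda>t. (t, x))"]) auto
qed

lemma path_component_of_continuous_image:
  assumes "continuous_map X Y f" "path_component_of X x y"
  shows "path_component_of Y (f x) (f y)"
proof -
  obtain p where "pathin X p" "p 0 = x" "p 1 = y"
    using assms(2) by (auto simp: path_component_of_def)
  then show ?thesis
    unfolding path_component_of_def
    using pathin_compose[OF _ assms(1)] by (intro exI[of _ "f \<circ> p"]) auto
qed

text \<open>Each track of the homotopy ends at the point it belongs to, so tracks of points of
  \<open>C\<close> never leave \<open>C\<close>. The homotopy therefore restricts to
  \<open>C\<close>, where it joins a constant map to the identity.\<close>

lemma homotopic_constant_on_imp_contractible_path_component:
  assumes C: "C \<in> path_components_of Y"
    and hom: "homotopic_with (\<lambda>_. True) Y Y f id"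
    and const: "\<And>x. x \<in> C \<Longrightarrow> f x = a"
  shows "contractible_space (subtopology Y C)"
proof -
  have CY: "C \<subseteq> topspace Y"
    using C by (rule path_components_of_subset)
  have stay: "y \<in> C" if "x \<in> C" "path_component_of Y x y" for x y
    using path_component_of_set_eq_component[OF C] that by blast
  obtain h where h: "continuous_map (prod_topology (top_of_set {0..1::real}) Y) Y h"
    and h0: "\<And>x. h (0, x) = f x" and h1: "\<And>x. h (1, x) = x"
    using hom by (auto simp: homotopic_with_def)
  have htC: "h (t, x) \<in> C" if "t \<in> {0..1}" "x \<in> C" for t x
  proof -
    have "path_component_of Y x (h (t, x))"
    proof -
      \<comment> \<open>The time parameter runs backwards from 1, where \<open>h\<close> is the
        identity, to \<open>t\<close>; this part of the track joins \<open>x\<close> to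
        \<open>h (t, x)\<close>.\<close>
      have "continuous_map (top_of_set {0..1}) (prod_topology (top_of_set {0..1::real}) Y)
          (\<lambda>s. (1 - s * (1 - t), x))"
      proof (intro continuous_map_pairedI)
        have "s * (1 - t) \<le> 1" if "s \<in> {0..1}" for s
          using that \<open>t \<in> {0..1}\<close> by (intro mult_le_one) auto
        then show "continuous_map (top_of_set {0..1}) (top_of_set {0..1}) (\<lambda>s. 1 - s * (1 - t))"
          using \<open>t \<in> {0..1}\<close> by (auto intro!: continuous_intros)
        show "continuous_map (top_of_set {0..1}) Y (\<lambda>s::real. x)"
          using \<open>x \<in> C\<close> CY by auto
      qed
      then have "pathin Y (h \<circ> (\<lambda>s. (1 - s * (1 - t), x)))"
        unfolding pathin_def using h by (rule continuous_map_compose)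
      then show ?thesis
        unfolding path_component_of_def using h1
        by (intro exI[of _ "h \<circ> (\<lambda>s. (1 - s * (1 - t), x))"]) auto
    qed
    then show ?thesis
      using stay \<open>x \<in> C\<close> by blast
  qed
  have "continuous_map (prod_topology (top_of_set {0..1::real}) (subtopology Y C)) (subtopology Y C) h"
  proof (rule continuous_map_into_subtopology)
    have "prod_topology (top_of_set {0..1::real}) (subtopology Y C) =
        subtopology (prod_topology (top_of_set {0..1}) Y) ({0..1} \<times> C)"
      by (simp add: prod_topology_subtopology(2))
    then show "continuous_map (prod_topology (top_of_set {0..1::real}) (subtopology Y C)) Y h"
      using h by (simp add: continuous_map_from_subtopology)
  qed (use htC in auto)
  then have "homotopic_with (\<lambda>_. True) (subtopology Y C) (subtopology Y C) f id"
    using h0 h1 by (auto simp: homotopic_with_def)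
  then have "homotopic_with (\<lambda>_. True) (subtopology Y C) (subtopology Y C) (\<lambda>x. a) id"
    by (rule homotopic_with_eq) (use const in auto)
  then show ?thesis
    unfolding contractible_space_def by (metis homotopic_with_sym)
qed

text \<open>A homotopy equivalence is injective on path components, so \<open>C\<close> is the whole
  preimage of an open path component of \<open>K\<close>.\<close>

lemma openin_path_components_homotopy_equivalent:
  assumes "Y homotopy_equivalent_space K"
    and K: "\<And>D. D \<in> path_components_of K \<Longrightarrow> openin K D"
    and C: "C \<in> path_components_of Y"
  shows "openin Y C"
proof -
  obtain f g where f: "continuous_map Y K f" and g: "continuous_map K Y g"
    and gf: "homotopic_with (\<lambda>_. True) Y Y (g \<circ> f) id"
    using assms(1) by (auto simp: homotopy_equivalent_space_def)
  obtain x where x: "x \<in> topspace Y" and Cx: "C = path_component_of_set Y x"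
    using C by (auto simp: path_components_of_def)
  let ?D = "path_component_of_set K (f x)"
  have "openin K ?D"
    using K x f by (auto simp: path_components_of_def continuous_map_def)
  then have "openin Y {y \<in> topspace Y. f y \<in> ?D}"
    using f by (rule openin_continuous_map_preimage[rotated])
  moreover have "{y \<in> topspace Y. f y \<in> ?D} = C"
  proof
    show "C \<subseteq> {y \<in> topspace Y. f y \<in> ?D}"
      using path_component_of_continuous_image[OF f] path_component_in_topspace[of Y x] Cx by auto
    show "{y \<in> topspace Y. f y \<in> ?D} \<subseteq> C"
    proof
      fix y assume "y \<in> {y \<in> topspace Y. f y \<in> ?D}"
      then have y: "y \<in> topspace Y" and "path_component_of Y (g (f x)) (g (f y))"
        using path_component_of_continuous_image[OF g] by auto
      \<comment> \<open>Used for \<open>z = x\<close> and \<open>z = y\<close>, this closes the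
        chain from \<open>x\<close> through \<open>g (f x)\<close> and \<open>g (f y)\<close> to
        \<open>y\<close>.\<close>
      moreover have "path_component_of Y (g (f z)) z" if "z \<in> topspace Y" for z
        using homotopic_imp_path_component_of[OF gf that] by simp
      ultimately show "y \<in> C"
        using x Cx by (metis mem_Collect_eq path_component_of_sym path_component_of_trans)
    qed
  qed
  ultimately show ?thesis
    by simp
qed

text \<open>The preimage of the point \<open>C\<close> under the quotient map is the set
  \<open>C\<close> itself, and a space is discrete exactly when its points are open.\<close>

lemma pi0_eq_discrete_iff:
  "pi0 Y = discrete_topology (path_components_of Y) \<longleftrightarrow>
    (\<forall>C \<in> path_components_of Y. openin Y C)"
proof -
  have "{y \<in> topspace Y. path_component_of_set Y y \<in> {C}} = C" if "C \<in> path_components_of Y" for C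
  proof (intro subset_antisym subsetI)
    fix y assume "y \<in> {y \<in> topspace Y. path_component_of_set Y y \<in> {C}}"
    then have "path_component_of_set Y y = C" "path_component_of Y y y"
      by (auto simp only: path_component_of_refl mem_Collect_eq singleton_iff)
    then show "y \<in> C"
      by blast
  next
    fix y assume "y \<in> C"
    then show "y \<in> {y \<in> topspace Y. path_component_of_set Y y \<in> {C}}"
      using path_component_of_set_eq_component[OF that] path_components_of_subset[OF that]
      by blast
  qed
  then have *: "openin (pi0 Y) {C} \<longleftrightarrow> openin Y C" if "C \<in> path_components_of Y" for C
    using that by (simp only: openin_pi0) simp
  have "pi0 Y = discrete_topology (path_components_of Y) \<longleftrightarrow>
      (\<forall>C \<in> path_components_of Y. openin (pi0 Y) {C})"
    by (subst eq_commute) (simp add: discrete_topology_unique topspace_pi0)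
  then show ?thesis
    using * by simp
qed

section \<open>Discrete spaces\<close>

lemma CW_complex_discrete_topology: "CW_complex (discrete_topology S)"
proof -
  let ?Y = "discrete_topology S" and ?E = "(\<lambda>s. {s}) ` S"
  have "homeomorphic_map (subtopology (cw_disc 0) (cw_open_disc 0)) (subtopology ?Y {s})
      (\<lambda>_. s)" if "s \<in> S" for s
  proof (rule bijective_open_imp_homeomorphic_map)
    have sp: "topspace (subtopology (cw_disc 0) (cw_open_disc 0)) = {\<lambda>_. 0}"
      by (auto simp: topspace_cw_disc cw_open_disc_def topspace_Euclidean_space)
    show "(\<lambda>_. s) ` topspace (subtopology (cw_disc 0) (cw_open_disc 0)) =
        topspace (subtopology ?Y {s})"
      using that unfolding sp by auto
    show "inj_on (\<lambda>_. s) (topspace (subtopology (cw_disc 0) (cw_open_disc 0)))"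
      unfolding sp by auto
  qed (use that in \<open>auto simp: open_map_def subtopology_discrete_topology\<close>)
  \<comment> \<open>Every point is a 0-cell. An empty sum is not 1, so
    \<open>cw_disc_boundary 0\<close> is empty and closure finiteness holds with no cells.\<close>
  then have "CW_structure ?Y ?E (\<lambda>_. 0) (\<lambda>e _. the_elem e)"
    unfolding CW_structure_def
    by (auto simp: disjoint_def cw_disc_boundary_def)
  then show ?thesis
    by (auto simp: CW_complex_def)
qed

text \<open>\<open>S\<close> consists of the end points of chosen contractions, one in each
  component; one map sends a point to the end point of its component, the other is the inclusion.
  Representing components by points keeps the discrete space on the type \<open>'a\<close>.\<close>

lemma homotopy_equivalent_discrete:
  fixes Y :: "'a topology"
  assumes op: "\<And>C. C \<in> path_components_of Y \<Longrightarrow> openin Y C"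
    and contr: "\<And>C. C \<in> path_components_of Y \<Longrightarrow> contractible_space (subtopology Y C)"
  obtains S :: "'a set" where "Y homotopy_equivalent_space discrete_topology S"
proof -
  let ?I = "top_of_set {0..1::real}" and ?P = "path_components_of Y"
  let ?c = "path_component_of_set Y"
  have "\<exists>a h. continuous_map (prod_topology ?I (subtopology Y C)) (subtopology Y C) h \<and>
      (\<forall>x. h (0, x) = x) \<and> (\<forall>x. h (1, x) = a)" if "C \<in> ?P" for C
    using contr[OF that] by (auto simp: contractible_space_def homotopic_with_def)
  then obtain a h where h: "\<And>C. C \<in> ?P \<Longrightarrow>
      continuous_map (prod_topology ?I (subtopology Y C)) (subtopology Y C) (h C)"
    and h0: "\<And>C x. C \<in> ?P \<Longrightarrow> h C (0, x) = x"
    and h1: "\<And>C x. C \<in> ?P \<Longrightarrow> h C (1, x) = a C"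
    by metis
  have cP: "?c y \<in> ?P" "y \<in> ?c y" if "y \<in> topspace Y" for y
    using that by (auto simp: path_components_of_def path_component_of_refl)
  have ceq: "?c y = C" if "C \<in> ?P" "y \<in> C" for C y
    using path_component_of_set_eq_component that by metis
  have CY: "C \<subseteq> topspace Y" if "C \<in> ?P" for C
    using that by (rule path_components_of_subset)
  have aC: "a C \<in> C" if "C \<in> ?P" for C
  proof -
    obtain x where "x \<in> C"
      using nonempty_path_components_of[OF \<open>C \<in> ?P\<close>] by blast
    then have "h C (1, x) \<in> C"
      using h[OF that] CY[OF that] by (auto simp: continuous_map_def Pi_iff)
    then show ?thesis
      using h1[OF that] by simp
  qed
  let ?S = "a ` ?P" and ?f = "\<lambda>y. a (?c y)"
  \<comment> \<open>Local constancy of the component map gives continuity into a discrete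
    space.\<close>
  have local: "\<exists>U. openin Y U \<and> y \<in> U \<and> (\<forall>z\<in>U. ?c z = ?c y)" if "y \<in> topspace Y" for y
    using cP[OF that] op ceq by blast
  have f: "continuous_map Y (discrete_topology ?S) ?f"
    unfolding continuous_map_def
  proof (intro conjI allI impI)
    show "?f \<in> topspace Y \<rightarrow> topspace (discrete_topology ?S)"
      using cP by auto
    fix U
    show "openin Y {y \<in> topspace Y. ?f y \<in> U}"
      by (subst openin_subopen) (smt (verit, best) local mem_Collect_eq openin_subset subset_iff)
  qed
  have g: "continuous_map (discrete_topology ?S) Y id"
    using aC CY by (auto simp: Pi_iff)
  have fg: "homotopic_with (\<lambda>_. True) (discrete_topology ?S) (discrete_topology ?S) (?f \<circ> id) id"
  proof (rule homotopic_with_equal)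
    show "continuous_map (discrete_topology ?S) (discrete_topology ?S) (?f \<circ> id)"
      using g f by (rule continuous_map_compose)
  qed (use aC ceq in auto)
  define H where "H = (\<lambda>(t, y). h (?c y) (t, y))"
  have "continuous_map (prod_topology ?I Y) Y H"
  \<comment> \<open>The slabs \<open>{0..1} \<times> C\<close> are open and pairwise disjoint, so
    the contractions agree on overlaps automatically.\<close>
  proof (rule pasting_lemma)
    show "openin (prod_topology ?I Y) ({0..1} \<times> C)" if "C \<in> ?P" for C
      using op[OF that] by (simp add: openin_prod_Times_iff)
    show "continuous_map (subtopology (prod_topology ?I Y) ({0..1} \<times> C)) Y (h C)" if "C \<in> ?P" for C
      using h[OF that]
      by (simp add: prod_topology_subtopology continuous_map_in_subtopology
            subtopology_subtopology flip: subtopology_Times)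
    show "h C z = h D z" if "C \<in> ?P" "D \<in> ?P"
      "z \<in> topspace (prod_topology ?I Y) \<inter> ({0..1} \<times> C) \<inter> ({0..1} \<times> D)" for C D z
      using that ceq by (metis IntE SigmaE2 prod.collapse)
    show "\<exists>C. C \<in> ?P \<and> z \<in> {0..1} \<times> C \<and> H z = h C z" if "z \<in> topspace (prod_topology ?I Y)" for z
      using that cP by (auto simp: H_def)
  qed
  moreover have "homotopic_with (\<lambda>_. True) Y Y id (id \<circ> ?f)"
    if "continuous_map (prod_topology ?I Y) Y H"
    using that cP(1) h0 h1 by (subst homotopic_with) (auto simp: H_def intro!: exI[of _ H])
  ultimately have "homotopic_with (\<lambda>_. True) Y Y (id \<circ> ?f) id"
    by (simp add: homotopic_with_symD)
  with f g fg have "Y homotopy_equivalent_space discrete_topology ?S"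
    unfolding homotopy_equivalent_space_def by blast
  then show thesis
    by (rule that)
qed

section \<open>The Up topology\<close>

context M_poset
begin

text \<open>Basic sets are up-closed by transitivity of the order, and unions inherit this.\<close>

lemma openin_up_topology_upclosed:
  assumes "openness_property X le R \<mu>" "openin (up_topology X le R \<mu>) U"
    "x \<in> U" "(x, y) \<in> le"
  shows "y \<in> U"
proof -
  have "trans le"
    using partial_order by (auto dest: partial_order_onD)
  moreover obtain V where "up_basic X le R \<mu> V" "x \<in> V" "V \<subseteq> U"
    using assms(2,3) unfolding openin_up_topology[OF assms(1)] union_of_def by auto
  ultimately show ?thesis
    using \<open>(x, y) \<in> le\<close> by (auto simp: up_basic_def upset_def dest: transD)
qed

text \<open>An open set around the image of the smaller point that misses the image of the larger
  one would pull back to an up-closed set containing \<open>x\<close> but not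
  \<open>y\<close>.\<close>

lemma le_imp_continuous_map_eq:
  assumes op: "openness_property X le R \<mu>"
    and f: "continuous_map (up_topology X le R \<mu>) K f" and K: "t1_space K"
    and xy: "(x, y) \<in> le"
  shows "f x = f y"
proof (rule ccontr)
  assume ne: "f x \<noteq> f y"
  let ?Y = "up_topology X le R \<mu>"
  have "x \<in> topspace ?Y" "y \<in> topspace ?Y"
    using xy partial_order topspace_up_topology[OF op] by (auto dest: partial_order_onD)
  then obtain U where U: "openin K U" "f x \<in> U" "f y \<notin> U"
    using K f ne unfolding t1_space_def continuous_map_def by (metis PiE)
  have "openin ?Y {z \<in> topspace ?Y. f z \<in> U}"
    using f U(1) by (rule openin_continuous_map_preimage)
  then have "y \<in> {z \<in> topspace ?Y. f z \<in> U}"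
    using openin_up_topology_upclosed[OF op _ _ xy] U(2) \<open>x \<in> topspace ?Y\<close> by blast
  then show False
    using U(3) by simp
qed

text \<open>Under discrete type any two points of \<open>C\<close> are joined by a finite chain of
  comparable points, and \<open>f\<close> takes equal values along each link.\<close>

lemma continuous_map_constant_on_path_component:
  assumes op: "openness_property X le R \<mu>" and disc: "discrete_type X le R \<mu>"
    and f: "continuous_map (up_topology X le R \<mu>) K f" and K: "t1_space K"
    and C: "C \<in> path_components_of (up_topology X le R \<mu>)" "x \<in> C" "y \<in> C"
  shows "f x = f y"
proof -
  have x: "x \<in> topspace X"
    using C path_components_of_subset topspace_up_topology[OF op] by blast
  have "zigzag X le `` {x} \<in> path_components_of (up_topology X le R \<mu>)"
    using disc x by (auto simp: discrete_type_def intro: quotientI)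
  moreover have "x \<in> zigzag X le `` {x}"
    using x by (simp add: zigzag_def)
  \<comment> \<open>Both sets are path components and share \<open>x\<close>, while distinct path
    components are disjoint.\<close>
  ultimately have "zigzag X le `` {x} = C"
    using C pairwiseD[OF pairwise_disjoint_path_components_of] by (auto simp: disjnt_iff)
  then have "(x, y) \<in> (le \<union> le\<inverse>)\<^sup>*"
    using C(3) by (auto simp: zigzag_def)
  then show ?thesis
    by induction (use le_imp_continuous_map_eq[OF op f K] in auto)
qed

end

section \<open>The criterion for the homotopy type of a CW complex\<close>

theorem theorem9p2:
  fixes X :: "'a topology" and le :: "'a rel"
    and R :: "'r set" and leR :: "'r rel" and \<mu> :: "'a \<Rightarrow> 'r"
  assumes "M_poset X le R leR \<mu>"
    and "openness_property X le R \<mu>"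
    and "discrete_type X le R \<mu>"
  shows "has_CW_homotopy_type TYPE('c) (up_topology X le R \<mu>) \<longleftrightarrow>
         (\<forall>C \<in> path_components_of (up_topology X le R \<mu>).
            contractible_space (subtopology (up_topology X le R \<mu>) C)) \<and>
         pi0 (up_topology X le R \<mu>) = discrete_topology (path_components_of (up_topology X le R \<mu>))"
    (is "_ \<longleftrightarrow> ?rhs")
proof -
  interpret M_poset X le R leR \<mu>
    by (rule assms(1))
  let ?Y = "up_topology X le R \<mu>"
  show ?thesis
  proof
    assume "has_CW_homotopy_type TYPE('c) ?Y"
    then obtain K :: "('a \<times> real + 'c) topology"
      where K: "CW_complex K" and eq: "?Y homotopy_equivalent_space K"
      by (auto simp: has_CW_homotopy_type_def)
    obtain f g where f: "continuous_map ?Y K f"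
      and gf: "homotopic_with (\<lambda>_. True) ?Y ?Y (g \<circ> f) id"
      using eq by (auto simp: homotopy_equivalent_space_def)
    have "t1_space K"
      using K by (auto simp: CW_complex_def CW_structure_def Hausdorff_imp_t1_space)
    note const = continuous_map_constant_on_path_component[OF assms(2,3) f this]
    have "contractible_space (subtopology ?Y C)" if C: "C \<in> path_components_of ?Y" for C
    proof -
      obtain x where x: "x \<in> C"
        using nonempty_path_components_of[OF C] by blast
      have "(g \<circ> f) y = g (f x)" if "y \<in> C" for y
        using const[OF C that x] by simp
      with C gf show ?thesis
        by (rule homotopic_constant_on_imp_contractible_path_component)
    qed
    moreover have "openin ?Y C" if "C \<in> path_components_of ?Y" for C
      using eq openin_path_components_CW[OF K] that
      by (rule openin_path_components_homotopy_equivalent)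
    ultimately show ?rhs
      by (simp add: pi0_eq_discrete_iff)
  next
    assume ?rhs
    then have "\<And>C. C \<in> path_components_of ?Y \<Longrightarrow> openin ?Y C"
      and "\<And>C. C \<in> path_components_of ?Y \<Longrightarrow> contractible_space (subtopology ?Y C)"
      by (auto simp: pi0_eq_discrete_iff)
    then obtain S :: "'a set" where S: "?Y homotopy_equivalent_space discrete_topology S"
      by (rule homotopy_equivalent_discrete)
    \<comment> \<open>An injection copies \<open>S\<close> into the carrier type fixed by
      \<open>has_CW_homotopy_type\<close>; the value 0 is arbitrary.\<close>
    define i :: "'a \<Rightarrow> 'a \<times> real + 'c" where "i = (\<lambda>s. Inl (s, 0))"
    have "homeomorphic_map (discrete_topology S) (discrete_topology (i ` S)) i"
      by (rule bijective_open_imp_homeomorphic_map)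
        (auto simp: i_def inj_on_def open_map_def)
    then have "discrete_topology S homotopy_equivalent_space discrete_topology (i ` S)"
      by (meson homeomorphic_imp_homotopy_equivalent_space homeomorphic_map_imp_homeomorphic_space)
    with S have "?Y homotopy_equivalent_space discrete_topology (i ` S)"
      by (rule homotopy_eqv_trans)
    then show "has_CW_homotopy_type TYPE('c) ?Y"
      unfolding has_CW_homotopy_type_def using CW_complex_discrete_topology by blast
  qed
qed

end
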